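(* Let $\mathscr M$ be a complex inner product space, let $T:\mathscr M\to\mathscr M$ be a linear operator, let $z_1,z_2\in\mathbb T$ with $z_1\neq z_2$, and let $h_j\in\mathscr E_{T;z_j}$ for $j=1,2$. Then: (i) if $z_1=-z_2$ and $\|T^n(h_1+h_2)\|^2$ is a polynomial in $n$, then $\mathrm{Re}\,\langle T^nh_1,T^nh_2\rangle=0$ for all $n\in\mathbb Z_+$; (ii) if $z_1=-z_2$ and there is $(\epsilon_1,\epsilon_2)\in\{-1,1\}\times\{-\mathrm i,\mathrm i\}$ such that $\|T^n(\epsilon_kh_1+h_2)\|^2$ is a polynomial in $n$ for $k=1,2$, then $\langle T^nh_1,T^nh_2\rangle=0$ for all $n\in\mathbb Z_+$; (iii) if $z_1\neq-z_2$ and $\|T^n(h_1+h_2)\|^2$ is a polynomial in $n$, then $\langle T^nh_1,T^nh_2\rangle=0$ for all $n\in\mathbb Z_+$.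
   Context: $\mathbb T=\{z\in\mathbb C:|z|=1\}$, $\mathbb N$ is the set of positive integers, $\mathbb Z_+$ the set of nonnegative integers. $\mathscr M$ need not be complete and $T$ need not be bounded. For $z\in\mathbb C$, $\mathscr E_{T;z}=\bigcup_{n\in\mathbb N}\ker((T-zI)^n)$ (the generalized eigenspace, including $0$). A complex sequence $\{\gamma_n\}_{n=0}^\infty$ is a polynomial in $n$ if there is $p\in\mathbb C[x]$ with $\gamma_n=p(n)$ for all $n\in\mathbb Z_+$. *)

theory Defs
  imports Complex_Main "HOL-Computational_Algebra.Polynomial"
begin

text \<open>
  A complex inner product space, not assumed complete: the vectors are all elements of the type,
  \<open>scale\<close> is the complex scalar multiplication, and the inner product is linear in its first
  argument. Positivity is stated for the real part only, since
  \<open>inner x x\<close> is real by \<open>inner_commute\<close>.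
\<close>

locale complex_inner_space = vector_space scale
  for scale :: "complex \<Rightarrow> 'a::ab_group_add \<Rightarrow> 'a" +
  fixes inner :: "'a \<Rightarrow> 'a \<Rightarrow> complex"
  assumes inner_commute: "inner x y = cnj (inner y x)"
    and inner_add_left: "inner (x + y) w = inner x w + inner y w"
    and inner_scale_left: "inner (scale c x) y = c * inner x y"
    and inner_ge_zero: "0 \<le> Re (inner x x)"
    and inner_eq_zero: "inner x x = 0 \<Longrightarrow> x = 0"

definition inner_norm :: "('a \<Rightarrow> 'a \<Rightarrow> complex) \<Rightarrow> 'a \<Rightarrow> real" where
  "inner_norm inner x = sqrt (Re (inner x x))"

definition gen_eigenspace ::
    "(complex \<Rightarrow> 'a::ab_group_add \<Rightarrow> 'a) \<Rightarrow> ('a \<Rightarrow> 'a) \<Rightarrow> complex \<Rightarrow> 'a set" where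
  "gen_eigenspace scale T z = (\<Union>n\<in>{1..}. {h. ((\<lambda>x. T x - scale z x) ^^ n) h = 0})"

definition polynomial_seq :: "(nat \<Rightarrow> complex) \<Rightarrow> bool" where
  "polynomial_seq \<gamma> \<longleftrightarrow> (\<exists>p :: complex poly. \<forall>n. \<gamma> n = poly p (of_nat n))"

end

theory Submission
  imports Defs
begin

text \<open>
  Expanding \<open>T ^^ n\<close> around \<open>z\<^sub>j\<close> writes \<open>(T ^^ n) h\<^sub>j\<close> as \<open>z\<^sub>j ^ n\<close> times a polynomial in \<open>n\<close>
  with vector coefficients. Hence the squared norm of \<open>(T ^^ n) (h\<^sub>1 + h\<^sub>2)\<close> is a polynomial plus
  \<open>w ^ n * q n + cnj w ^ n * cnj (q n)\<close>, where \<open>w = z\<^sub>1 * cnj z\<^sub>2 \<noteq> 1\<close> and \<open>q\<close> is a polynomial.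
  Exponential polynomials with distinct bases are linearly independent. If \<open>w \<noteq> -1\<close>, the bases
  \<open>1\<close>, \<open>w\<close>, \<open>cnj w\<close> are distinct and \<open>q = 0\<close>; if \<open>w = -1\<close>, only \<open>q + cnj q = 0\<close> follows.
\<close>

section \<open>Linear independence of exponential polynomials\<close>

lemma coeff_pcompose_shift_degree:
  fixes p :: "'a::field_char_0 poly"
  shows "coeff (pcompose p [:1, 1:]) (degree p) = lead_coeff p"
  using lead_coeff_comp[of "[:1, 1:]" p] by (simp add: degree_pcompose)

lemma poly_eq_0_if_zero_on_nat:
  fixes p :: "'a::field_char_0 poly"
  assumes "\<And>n. poly p (of_nat n) = 0"
  shows "p = 0"
proof (rule ccontr)
  assume "p \<noteq> 0"
  then have "finite {x. poly p x = 0}" by (rule poly_roots_finite)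
  moreover have "range of_nat \<subseteq> {x. poly p x = 0}" using assms by auto
  moreover have "infinite (range (of_nat :: nat \<Rightarrow> 'a))"
    by (simp add: finite_image_iff inj_of_nat)
  ultimately show False using finite_subset by blast
qed

text \<open>Outer induction on the set of bases, inner induction on a degree bound at the new base
  \<open>c\<close>. Base 0 is excluded because \<open>0 ^ n\<close> vanishes for positive
  \<open>n\<close> and would constrain only one value of its polynomial.\<close>

lemma exponential_polynomials_independent:
  fixes p :: "'a::field_char_0 \<Rightarrow> 'a poly"
  assumes "finite A" and "0 \<notin> A"
    and "\<And>n. (\<Sum>a\<in>A. a ^ n * poly (p a) (of_nat n)) = 0"
    and "a \<in> A"
  shows "p a = 0"
  using assms
proof (induction A arbitrary: p a rule: finite_induct)
  case empty
  then show ?case by simp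
next
  case (insert c A)
  have c: "c \<noteq> 0" using insert.prems by auto
  \<comment> \<open>The bound \<open>d\<close> is strict, so \<open>d = 0\<close> means
    \<open>p c = 0\<close> and the outer hypothesis applies to what remains.\<close>
  have step: "\<forall>a\<in>insert c A. p a = 0"
    if "\<And>n. c ^ n * poly (p c) (of_nat n) + (\<Sum>a\<in>A. a ^ n * poly (p a) (of_nat n)) = 0"
      and "\<And>i. i \<ge> d \<Longrightarrow> coeff (p c) i = 0" for d p
    using that
  proof (induction d arbitrary: p)
    case 0
    then have "p c = 0" by (auto simp: poly_eq_iff)
    moreover have "p a = 0" if "a \<in> A" for a
    proof (rule insert.IH)
      show "(\<Sum>a\<in>A. a ^ n * poly (p a) (of_nat n)) = 0" for n
        using "0.prems"(1)[of n] \<open>p c = 0\<close> by simp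
    qed (use that insert.prems(1) in auto)
    ultimately show ?case by auto
  next
    case (Suc d)
    \<comment> \<open>Applying (shift - \<open>c\<close>) to the relation lowers the degree at \<open>c\<close> and is injective at
      every other base.\<close>
    define D where "D b = smult b (pcompose (p b) [:1, 1:]) - smult c (p b)" for b
    have D: "b ^ n * poly (D b) (of_nat n) =
        b ^ Suc n * poly (p b) (of_nat (Suc n)) - c * (b ^ n * poly (p b) (of_nat n))" for b n
      by (simp add: D_def poly_pcompose algebra_simps)
    have "c ^ n * poly (D c) (of_nat n) + (\<Sum>a\<in>A. a ^ n * poly (D a) (of_nat n)) = 0" for n
    proof -
      have "c ^ n * poly (D c) (of_nat n) + (\<Sum>a\<in>A. a ^ n * poly (D a) (of_nat n))
        = (c ^ Suc n * poly (p c) (of_nat (Suc n))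
            + (\<Sum>a\<in>A. a ^ Suc n * poly (p a) (of_nat (Suc n))))
          - c * (c ^ n * poly (p c) (of_nat n) + (\<Sum>a\<in>A. a ^ n * poly (p a) (of_nat n)))"
        unfolding D sum_subtractf by (simp only: sum_distrib_left[symmetric]) (simp only: algebra_simps)
      then show ?thesis using Suc.prems(1)[of n] Suc.prems(1)[of "Suc n"] by simp
    qed
    moreover have "coeff (D c) i = 0" if "i \<ge> d" for i
    \<comment> \<open>At the degree of \<open>p c\<close> the two leading terms cancel, since the
      shift keeps the leading coefficient; any other \<open>i\<close> lies above the degree.\<close>
    proof (cases "degree (p c) = i")
      case True
      then show ?thesis
        using coeff_pcompose_shift_degree[of "p c"] by (simp add: D_def)
    next
      case False
      have "degree (p c) < i"
      proof (rule ccontr)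
        assume "\<not> degree (p c) < i"
        with False that have "Suc d \<le> degree (p c)" by simp
        then have "p c = 0" using Suc.prems(2) leading_coeff_0_iff by blast
        with \<open>Suc d \<le> degree (p c)\<close> show False by simp
      qed
      then show ?thesis by (simp add: D_def coeff_eq_0 degree_pcompose)
    qed
    ultimately have D0: "\<forall>a\<in>insert c A. D a = 0" by (rule Suc.IH)
    have pA: "p a = 0" if "a \<in> A" for a
    proof (rule ccontr)
      assume "p a \<noteq> 0"
      have "coeff (D a) (degree (p a)) = (a - c) * lead_coeff (p a)"
        by (simp add: D_def coeff_pcompose_shift_degree algebra_simps)
      with D0 that \<open>p a \<noteq> 0\<close> have "a = c" by simp
      with insert.hyps that show False by simp
    qed
    \<comment> \<open>\<open>D c = 0\<close> alone would only make \<open>p c\<close> constant, so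
      the original relation is used, now reduced to its term at \<open>c\<close>.\<close>
    have "p c = 0"
    proof (rule poly_eq_0_if_zero_on_nat)
      show "poly (p c) (of_nat n) = 0" for n
        using Suc.prems(1)[of n] pA c by simp
    qed
    with pA show ?case by simp
  qed
  have "\<forall>a\<in>insert c A. p a = 0"
  proof (rule step)
    show "c ^ n * poly (p c) (of_nat n) + (\<Sum>a\<in>A. a ^ n * poly (p a) (of_nat n)) = 0" for n
      using insert.prems(2)[of n] insert.hyps by simp
    show "coeff (p c) i = 0" if "i \<ge> Suc (degree (p c))" for i
      using that by (simp add: coeff_eq_0)
  qed
  with insert.prems(3) show ?case by blast
qed

lemma polynomial_seq_exponential_independent:
  assumes "finite A" and "0 \<notin> A"
    and f: "\<And>a. a \<in> A \<Longrightarrow> polynomial_seq (f a)"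
    and sum: "\<And>n. (\<Sum>a\<in>A. a ^ n * f a n) = 0"
    and "a \<in> A"
  shows "f a n = 0"
proof -
  obtain p where p: "\<And>a n. a \<in> A \<Longrightarrow> f a n = poly (p a) (of_nat n)"
    using f unfolding polynomial_seq_def by metis
  have "(\<Sum>a\<in>A. a ^ n * poly (p a) (of_nat n)) = 0" for n
    using sum[of n] p by simp
  then have "p a = 0"
    using assms by (intro exponential_polynomials_independent[of A]) auto
  with p \<open>a \<in> A\<close> show ?thesis by simp
qed

section \<open>Closure properties of polynomial sequences\<close>

lemma polynomial_seq_const: "polynomial_seq (\<lambda>n. c)"
  unfolding polynomial_seq_def by (rule exI[of _ "[:c:]"]) simp

lemma polynomial_seq_add:
  assumes "polynomial_seq f" and "polynomial_seq g"
  shows "polynomial_seq (\<lambda>n. f n + g n)"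
  using assms unfolding polynomial_seq_def by (metis poly_add)

lemma polynomial_seq_mult:
  assumes "polynomial_seq f" and "polynomial_seq g"
  shows "polynomial_seq (\<lambda>n. f n * g n)"
  using assms unfolding polynomial_seq_def by (metis poly_mult)

lemma polynomial_seq_diff:
  assumes "polynomial_seq f" and "polynomial_seq g"
  shows "polynomial_seq (\<lambda>n. f n - g n)"
  using assms unfolding polynomial_seq_def by (metis poly_diff)

lemma polynomial_seq_sum:
  assumes "\<And>i. i \<in> I \<Longrightarrow> polynomial_seq (f i)"
  shows "polynomial_seq (\<lambda>n. \<Sum>i\<in>I. f i n)"
  using assms
  by (induction I rule: infinite_finite_induct)
    (auto intro: polynomial_seq_const polynomial_seq_add)

text \<open>The argument \<open>n\<close> is real, so conjugation acts on the coefficients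
  only.\<close>

lemma polynomial_seq_cnj:
  assumes "polynomial_seq f"
  shows "polynomial_seq (\<lambda>n. cnj (f n))"
proof -
  obtain p where "\<And>n. f n = poly p (of_nat n)"
    using assms unfolding polynomial_seq_def by blast
  then have "cnj (f n) = poly (map_poly cnj p) (of_nat n)" for n
    by (induction p arbitrary: f) (simp_all add: map_poly_pCons)
  then show ?thesis unfolding polynomial_seq_def by blast
qed

text \<open>The witness is the falling factorial divided by \<open>fact k\<close>; it also vanishes
  for \<open>n < k\<close>, as required.\<close>

lemma polynomial_seq_choose: "polynomial_seq (\<lambda>n. of_nat (n choose k))"
  unfolding polynomial_seq_def
  by (rule exI[of _ "smult (1 / fact k) (\<Prod>i<k. [:- of_nat i, 1:])"])
    (simp add: binomial_gbinomial gbinomial_prod_rev poly_prod atLeast0LessThan)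

section \<open>Sesquilinearity of the inner product\<close>

context complex_inner_space
begin

lemma inner_add_right: "inner w (x + y) = inner w x + inner w y"
  by (metis inner_commute inner_add_left complex_cnj_add)

lemma inner_scale_right: "inner x (scale c y) = cnj c * inner x y"
  by (metis inner_commute inner_scale_left complex_cnj_mult)

lemma inner_zero_left [simp]: "inner 0 x = 0"
  using inner_add_left[of 0 0 x] by simp

lemma inner_zero_right [simp]: "inner x 0 = 0"
  using inner_add_right[of x 0 0] by simp

lemma inner_sum_left: "inner (\<Sum>i\<in>I. f i) y = (\<Sum>i\<in>I. inner (f i) y)"
  by (induction I rule: infinite_finite_induct) (simp_all add: inner_add_left)

lemma inner_sum_right: "inner y (\<Sum>i\<in>I. f i) = (\<Sum>i\<in>I. inner y (f i))"
  by (induction I rule: infinite_finite_induct) (simp_all add: inner_add_right)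

lemma inner_norm_squared: "complex_of_real ((inner_norm inner x)\<^sup>2) = inner x x"
proof -
  have "inner x x \<in> \<real>"
    using inner_commute[of x x] by (metis Reals_cnj_iff)
  then show ?thesis
    by (simp add: inner_norm_def inner_ge_zero of_real_Re)
qed

section \<open>Powers of a linear operator on generalized eigenvectors\<close>

context
  fixes T :: "'a \<Rightarrow> 'a"
  assumes linear_T: "Vector_Spaces.linear scale scale T"
begin

interpretation T: Vector_Spaces.linear scale scale T
  by (rule linear_T)

lemma linear_funpow_add: "(T ^^ n) (x + y) = (T ^^ n) x + (T ^^ n) y"
  by (induction n) (simp_all add: T.add)

lemma linear_funpow_scale: "(T ^^ n) (scale c x) = scale c ((T ^^ n) x)"
  by (induction n) (simp_all add: T.scale)

lemma gen_eigenspace_scale: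
  assumes "h \<in> gen_eigenspace scale T z"
  shows "scale c h \<in> gen_eigenspace scale T z"
proof -
  have "((\<lambda>x. T x - scale z x) ^^ n) (scale c h) = scale c (((\<lambda>x. T x - scale z x) ^^ n) h)" for n
    by (induction n)
      (simp_all add: T.scale scale_right_diff_distrib scale_left_commute)
  with assms show ?thesis by (auto simp: gen_eigenspace_def)
qed

text \<open>Binomial expansion of \<open>T\<close> as \<open>z\<close> plus a part that is nilpotent
  on \<open>h\<close>. Writing \<open>z ^ n / z ^ k\<close> avoids truncated subtraction for
  \<open>k > n\<close> and isolates the factor \<open>z ^ n\<close>.\<close>

lemma funpow_expansion:
  assumes "z \<noteq> 0" and zero: "((\<lambda>x. T x - scale z x) ^^ Suc m) h = 0"
  shows "(T ^^ n) h =
    (\<Sum>k<Suc m. scale (of_nat (n choose k) * z ^ n / z ^ k) (((\<lambda>x. T x - scale z x) ^^ k) h))"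
proof (induction n)
  case 0
  show ?case by (subst sum.lessThan_Suc_shift) simp
next
  case (Suc n)
  define v where "v k = ((\<lambda>x. T x - scale z x) ^^ k) h" for k
  define c where "c n k = of_nat (n choose k) * z ^ n / z ^ k" for n k
  have Tv: "T (v k) = scale z (v k) + v (Suc k)" for k
    by (simp add: v_def)
  have v_last: "v (Suc m) = 0"
    using zero by (simp add: v_def)
  have c0: "c (Suc n) 0 = c n 0 * z"
    by (simp add: c_def)
  \<comment> \<open>Pascal's rule with the powers of \<open>z\<close> included.\<close>
  have cS: "c (Suc n) (Suc k) = c n (Suc k) * z + c n k" for k
    using \<open>z \<noteq> 0\<close> by (simp add: c_def field_simps)
  have "(T ^^ Suc n) h = T (\<Sum>k<Suc m. scale (c n k) (v k))"
    using Suc by (simp add: v_def c_def)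
  also have "\<dots> = (\<Sum>k<Suc m. scale (c n k * z) (v k)) + (\<Sum>k<Suc m. scale (c n k) (v (Suc k)))"
    by (simp only: T.sum T.scale Tv scale_right_distrib scale_scale sum.distrib)
  \<comment> \<open>The second sum loses its last term because \<open>v (Suc m) = 0\<close>, so it
    matches the first sum without its initial term.\<close>
  also have "\<dots> = scale (c (Suc n) 0) (v 0) + (\<Sum>k<m. scale (c (Suc n) (Suc k)) (v (Suc k)))"
    by (subst sum.lessThan_Suc_shift)
      (simp add: v_last c0 cS scale_left_distrib sum.distrib)
  also have "\<dots> = (\<Sum>k<Suc m. scale (c (Suc n) k) (v k))"
    by (subst sum.lessThan_Suc_shift) simp
  finally show ?case by (simp only: v_def c_def)
qed

lemma gen_eigenspace_expansion:
  assumes "z \<noteq> 0" and "h \<in> gen_eigenspace scale T z"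
  obtains m :: nat and c :: "nat \<Rightarrow> nat \<Rightarrow> complex" and v :: "nat \<Rightarrow> 'a"
  where "\<And>k. polynomial_seq (c k)"
    and "\<And>n. (T ^^ n) h = (\<Sum>k<m. scale (z ^ n * c k n) (v k))"
proof -
  obtain m where "((\<lambda>x. T x - scale z x) ^^ Suc m) h = 0"
    using assms(2) unfolding gen_eigenspace_def
    by (auto simp del: funpow.simps dest!: Suc_le_D)
  note expansion = funpow_expansion[OF assms(1) this]
  show ?thesis
  proof
    show "polynomial_seq (\<lambda>n. of_nat (n choose k) * (1 / z ^ k))" for k
      by (intro polynomial_seq_mult polynomial_seq_choose polynomial_seq_const)
    show "(T ^^ n) h = (\<Sum>k<Suc m. scale (z ^ n * (of_nat (n choose k) * (1 / z ^ k)))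
        (((\<lambda>x. T x - scale z x) ^^ k) h))" for n
      unfolding expansion by (simp add: mult.commute del: sum.lessThan_Suc funpow.simps)
  qed
qed

text \<open>The second slot is conjugate-linear, so the factors \<open>z1 ^ n\<close> and
  \<open>z2 ^ n\<close> combine to the base \<open>z1 * cnj z2\<close>.\<close>

lemma inner_funpow_gen_eigenspace:
  assumes "z1 \<noteq> 0" and "z2 \<noteq> 0"
    and "h1 \<in> gen_eigenspace scale T z1" and "h2 \<in> gen_eigenspace scale T z2"
  obtains q where "polynomial_seq q"
    and "\<And>n. inner ((T ^^ n) h1) ((T ^^ n) h2) = (z1 * cnj z2) ^ n * q n"
proof -
  obtain m1 :: nat and c1 v1 where c1: "\<And>k. polynomial_seq (c1 k)"
    and h1: "\<And>n. (T ^^ n) h1 = (\<Sum>k<m1. scale (z1 ^ n * c1 k n) (v1 k))"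
    by (rule gen_eigenspace_expansion[OF assms(1,3)]) (rule that)
  obtain m2 :: nat and c2 v2 where c2: "\<And>k. polynomial_seq (c2 k)"
    and h2: "\<And>n. (T ^^ n) h2 = (\<Sum>k<m2. scale (z2 ^ n * c2 k n) (v2 k))"
    by (rule gen_eigenspace_expansion[OF assms(2,4)]) (rule that)
  show ?thesis
  proof
    show "polynomial_seq (\<lambda>n. \<Sum>k<m1. \<Sum>l<m2. c1 k n * (cnj (c2 l n) * inner (v1 k) (v2 l)))"
      by (intro polynomial_seq_sum polynomial_seq_mult polynomial_seq_cnj polynomial_seq_const
          c1 c2)
    show "inner ((T ^^ n) h1) ((T ^^ n) h2) = (z1 * cnj z2) ^ n *
        (\<Sum>k<m1. \<Sum>l<m2. c1 k n * (cnj (c2 l n) * inner (v1 k) (v2 l)))" for n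
      unfolding h1 h2 inner_sum_left inner_sum_right inner_scale_left inner_scale_right
        sum_distrib_left
      by (subst sum.swap) (simp add: power_mult_distrib mult_ac)
  qed
qed

section \<open>Cross terms in the squared norm\<close>

lemma polynomial_seq_norm_gen_eigenspace_sum:
  assumes z: "norm z1 = 1" "norm z2 = 1" "z1 \<noteq> z2"
    and h1: "h1 \<in> gen_eigenspace scale T z1" and h2: "h2 \<in> gen_eigenspace scale T z2"
    and poly: "polynomial_seq (\<lambda>n. complex_of_real ((inner_norm inner ((T ^^ n) (h1 + h2)))\<^sup>2))"
  shows "if z1 = - z2 then Re (inner ((T ^^ n) h1) ((T ^^ n) h2)) = 0
    else inner ((T ^^ n) h1) ((T ^^ n) h2) = 0"
proof -
  define w where "w = z1 * cnj z2"
  have nz: "z1 \<noteq> 0" "z2 \<noteq> 0" using z by auto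
  have cnj_eq: "cnj z1 = 1 / z1" "cnj z2 = 1 / z2"
    using z(1,2) nz complex_norm_square[of z1] complex_norm_square[of z2]
    by (simp_all add: field_simps)
  have w: "w \<noteq> 0" "w \<noteq> 1" "w * cnj w = 1" "w = -1 \<longleftrightarrow> z1 = - z2"
    using nz z(3) by (auto simp: w_def cnj_eq field_simps)
  obtain q1 where q1: "polynomial_seq q1"
      "\<And>n. inner ((T ^^ n) h1) ((T ^^ n) h1) = (z1 * cnj z1) ^ n * q1 n"
    by (rule inner_funpow_gen_eigenspace[OF nz(1) nz(1) h1 h1]) (rule that)
  obtain q2 where q2: "polynomial_seq q2"
      "\<And>n. inner ((T ^^ n) h2) ((T ^^ n) h2) = (z2 * cnj z2) ^ n * q2 n"
    by (rule inner_funpow_gen_eigenspace[OF nz(2) nz(2) h2 h2]) (rule that)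
  obtain q where q: "polynomial_seq q"
      "\<And>n. inner ((T ^^ n) h1) ((T ^^ n) h2) = w ^ n * q n"
    by (rule inner_funpow_gen_eigenspace[OF nz h1 h2, folded w_def]) (rule that)
  \<comment> \<open>Everything with base 1: on the unit circle both diagonal terms have
    \<open>z * cnj z = 1\<close>, and the given polynomial is subtracted.\<close>
  define r where
    "r n = q1 n + q2 n - complex_of_real ((inner_norm inner ((T ^^ n) (h1 + h2)))\<^sup>2)" for n
  have r: "polynomial_seq r"
    unfolding r_def by (intro polynomial_seq_diff polynomial_seq_add q1 q2 poly)
  have "inner ((T ^^ n) h2) ((T ^^ n) h1) = cnj w ^ n * cnj (q n)" for n
    by (subst inner_commute) (simp add: q(2))
  then have rel: "r n + w ^ n * q n + cnj w ^ n * cnj (q n) = 0" for n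
    unfolding r_def inner_norm_squared
    using nz by (simp add: linear_funpow_add inner_add_left inner_add_right q1(2) q2(2) q(2) cnj_eq)
  show ?thesis
  proof (cases "w = -1")
    case True
    \<comment> \<open>Here \<open>w\<close> and \<open>cnj w\<close> coincide, so only the sum of
      their coefficients is determined.\<close>
    define f where "f a = (if a = 1 then r else (\<lambda>n. q n + cnj (q n)))" for a :: complex
    have "f (-1) n = 0"
    proof (rule polynomial_seq_exponential_independent[of "{1, -1}" f])
      show "polynomial_seq (f a)" for a
        by (auto simp: f_def intro!: r q(1) polynomial_seq_add polynomial_seq_cnj)
      show "(\<Sum>a\<in>{1, -1}. a ^ n * f a n) = 0" for n
        using rel[of n] True by (simp add: f_def algebra_simps)
    qed auto
    then have "q n + cnj (q n) = 0" by (simp add: f_def)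
    then have "Re (q n) = 0" by (simp add: complex_add_cnj)
    moreover have "((-1) ^ n :: complex) = of_real ((-1) ^ n)" by simp
    ultimately have "Re (w ^ n * q n) = 0"
      unfolding True by (simp only: Re_complex_of_real Im_complex_of_real times_complex.simps)
    with True w(4) show ?thesis by (simp add: q(2))
  next
    case False
    \<comment> \<open>The only real points of the unit circle are 1 and -1, both excluded
      here.\<close>
    have "w \<noteq> cnj w"
    proof
      assume "w = cnj w"
      with w(3) have "w\<^sup>2 = 1" by (simp add: power2_eq_square)
      with w(2) False show False by (simp add: power2_eq_1_iff)
    qed
    define f where "f a = (if a = 1 then r else if a = w then q else (\<lambda>n. cnj (q n)))" for a
    have "f w n = 0"
    proof (rule polynomial_seq_exponential_independent[of "{1, w, cnj w}" f])
      show "polynomial_seq (f a)" for a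
        by (auto simp: f_def intro!: r q(1) polynomial_seq_cnj)
      show "(\<Sum>a\<in>{1, w, cnj w}. a ^ n * f a n) = 0" for n
        using rel[of n] \<open>w \<noteq> cnj w\<close> w(2) by (auto simp: f_def add.assoc)
    qed (use w(1) in auto)
    then have "q n = 0" using w(2) by (simp add: f_def)
    with False w(4) show ?thesis by (simp add: q(2))
  qed
qed

end

end

section \<open>The three assertions\<close>

theorem theorem5p3:
  fixes scale :: "complex \<Rightarrow> 'a::ab_group_add \<Rightarrow> 'a"
    and inner :: "'a \<Rightarrow> 'a \<Rightarrow> complex"
    and T :: "'a \<Rightarrow> 'a"
    and z1 z2 :: complex
    and h1 h2 :: 'a
  assumes "complex_inner_space scale inner"
    and "Vector_Spaces.linear scale scale T"
    and "norm z1 = 1" and "norm z2 = 1" and "z1 \<noteq> z2"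
    and "h1 \<in> gen_eigenspace scale T z1"
    and "h2 \<in> gen_eigenspace scale T z2"
  shows
    "(z1 = - z2 \<and>
        polynomial_seq (\<lambda>n. complex_of_real ((inner_norm inner ((T ^^ n) (h1 + h2)))\<^sup>2))
      \<longrightarrow> (\<forall>n. Re (inner ((T ^^ n) h1) ((T ^^ n) h2)) = 0)) \<and>
     (z1 = - z2 \<and>
        (\<exists>\<epsilon>1 \<epsilon>2. (\<epsilon>1, \<epsilon>2) \<in> {-1, 1} \<times> {-\<i>, \<i>} \<and>
          (\<forall>\<epsilon>\<in>{\<epsilon>1, \<epsilon>2}.
            polynomial_seq
              (\<lambda>n. complex_of_real ((inner_norm inner ((T ^^ n) (scale \<epsilon> h1 + h2)))\<^sup>2))))
      \<longrightarrow> (\<forall>n. inner ((T ^^ n) h1) ((T ^^ n) h2) = 0)) \<and>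
     (z1 \<noteq> - z2 \<and>
        polynomial_seq (\<lambda>n. complex_of_real ((inner_norm inner ((T ^^ n) (h1 + h2)))\<^sup>2))
      \<longrightarrow> (\<forall>n. inner ((T ^^ n) h1) ((T ^^ n) h2) = 0))"
proof -
  interpret complex_inner_space scale inner by fact
  \<comment> \<open>The membership of the first vector stays open, so that both \<open>h1\<close>
    and its multiples can be inserted.\<close>
  note key = polynomial_seq_norm_gen_eigenspace_sum[OF assms(2-5) _ assms(7)]
  have "inner ((T ^^ n) h1) ((T ^^ n) h2) = 0"
    if "z1 = - z2" and "(\<epsilon>1, \<epsilon>2) \<in> {-1, 1} \<times> {-\<i>, \<i>}"
      and poly: "\<forall>\<epsilon>\<in>{\<epsilon>1, \<epsilon>2}. polynomial_seq
        (\<lambda>n. complex_of_real ((inner_norm inner ((T ^^ n) (scale \<epsilon> h1 + h2)))\<^sup>2))"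
    for \<epsilon>1 \<epsilon>2 n
  proof -
    have "Re (\<epsilon> * inner ((T ^^ n) h1) ((T ^^ n) h2)) = 0" if "\<epsilon> \<in> {\<epsilon>1, \<epsilon>2}" for \<epsilon>
      using key[OF gen_eigenspace_scale[OF assms(2,6)], of \<epsilon> n] bspec[OF poly that] \<open>z1 = - z2\<close>
      by (simp only: linear_funpow_scale[OF assms(2)] inner_scale_left if_True)
    \<comment> \<open>The real factor \<open>\<epsilon>1\<close> kills the real part of the inner
      product, the imaginary factor \<open>\<epsilon>2\<close> its imaginary part.\<close>
    from this[of \<epsilon>1] this[of \<epsilon>2] that(2) show ?thesis
      by (auto simp: complex_eq_iff)
  qed
  with key[OF assms(6)] show ?thesis by (auto split: if_splits)
qed

end
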